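(* Let $X$ be a compact and convex subset of a uniformly convex normed space $(\widetilde{X},|\cdot|)$, let $K$ be a finite set with at least two elements, and let $(P_k)_{k\in K}$ be a tuple of nonempty, pairwise disjoint compact subsets of $X$. Suppose that for each $k\in K$ the set $P_k$ has the emanation property (with respect to $X$). Then there exists a zone diagram with respect to $(P_k)_{k\in K}$, that is, there exists a tuple $(R_k)_{k\in K}$ of nonempty subsets of $X$ such that $$R_k=\operatorname{dom}\Big(P_k,\bigcup_{j\neq k}R_j\Big)\quad\text{for all } k\in K.$$
   Context: Normed spaces may be real or complex, finite or infinite dimensional; $d(x,y)=|x-y|$ is the induced metric. A normed space is uniformly convex if for every $\epsilon\in(0,2]$ there is $\delta\in(0,1]$ such that $|x|=|y|=1$ and $|x-y|\ge\epsilon$ imply $|(x+y)/2|\le 1-\delta$. Dominance region: for nonempty $P,A\subseteq X$, $\operatorname{dom}(P,A)=\{x\in X: d(x,P)\le d(x,A)\}$, where $d(x,A)=\inf\{d(x,a):a\in A\}$. Emanation property: let $X$ be a closed and convex subset of a normed space and $p\in X$. Let $\Theta_p=\{\theta:|\theta|=1,\ p+t\theta\in X\text{ for some }t>0\}$. For $\theta\in\Theta_p$ let $L(\theta)\in(0,\infty]$ be the length of the intersection of $X$ with the ray emanating from $p$ in the direction $\theta$. The point $p$ has the emanation property in the direction $\theta\in\Theta_p$ if for each $\epsilon>0$ there exists $\beta>0$ such that every $\phi\in\Theta_p$ with $|\phi-\theta|<\beta$ satisfies $L(\phi)\ge L(\theta)-\epsilon$. The point $p$ has the emanation property if it has it in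 the direction of every $\theta\in\Theta_p$. A subset $C\subseteq X$ has the emanation property if every $p\in C$ has the emanation property. *)

theory Defs
  imports "HOL-Analysis.Analysis"
begin

text \<open>
  Normed spaces over the reals or the complex numbers are both covered by
  \<^class>\<open>real_normed_vector\<close>: convexity, rays, uniform convexity and distances involve
  real scalars only, so a complex space enters through its underlying real one.
  Completeness is not assumed.
\<close>

definition uniformly_convex_space :: "'a::real_normed_vector itself \<Rightarrow> bool" where
  "uniformly_convex_space _ \<longleftrightarrow>
    (\<forall>\<epsilon>::real. 0 < \<epsilon> \<and> \<epsilon> \<le> 2 \<longrightarrow>
      (\<exists>\<delta>::real. 0 < \<delta> \<and> \<delta> \<le> 1 \<and>
        (\<forall>x y :: 'a. norm x = 1 \<and> norm y = 1 \<and> norm (x - y) \<ge> \<epsilon> \<longrightarrow>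
          norm ((1 / 2) *\<^sub>R (x + y)) \<le> 1 - \<delta>)))"

text \<open>
  For nonempty \<open>A\<close>, \<^term>\<open>infdist x A\<close> is the infimum of the distances from \<open>x\<close> to \<open>A\<close>;
  dominance regions are only meaningful for nonempty \<open>P\<close> and \<open>A\<close>.
\<close>

definition dominance_region :: "'a::real_normed_vector set \<Rightarrow> 'a set \<Rightarrow> 'a set \<Rightarrow> 'a set" where
  "dominance_region X P A = {x \<in> X. infdist x P \<le> infdist x A}"

definition zone_diagram ::
    "'a::real_normed_vector set \<Rightarrow> 'k set \<Rightarrow> ('k \<Rightarrow> 'a set) \<Rightarrow> ('k \<Rightarrow> 'a set) \<Rightarrow> bool" where
  "zone_diagram X K P R \<longleftrightarrow>
    (\<forall>k\<in>K. R k \<noteq> {} \<and> R k \<subseteq> X) \<and>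
    (\<forall>k\<in>K. R k = dominance_region X (P k) (\<Union>j\<in>K - {k}. R j))"

definition ray_directions :: "'a::real_normed_vector set \<Rightarrow> 'a \<Rightarrow> 'a set" where
  "ray_directions X p = {\<theta>. norm \<theta> = 1 \<and> (\<exists>t::real. t > 0 \<and> p + t *\<^sub>R \<theta> \<in> X)}"

text \<open>
  For closed convex \<open>X\<close> containing \<open>p\<close> and a unit vector \<open>\<theta>\<close>, the ray from \<open>p\<close> in direction
  \<open>\<theta>\<close>, parametrised isometrically by \<open>t \<ge> 0\<close>, meets \<open>X\<close> in a segment starting at \<open>p\<close> or in
  the whole ray, so its length is the supremum of the admissible parameters, possibly \<open>\<infinity>\<close>.
  The lemma below confirms that this is the one-dimensional Lebesgue measure of the intersection.
\<close>

definition ray_length :: "'a::real_normed_vector set \<Rightarrow> 'a \<Rightarrow> 'a \<Rightarrow> ereal" where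
  "ray_length X p \<theta> = (SUP t \<in> {t::real. t \<ge> 0 \<and> p + t *\<^sub>R \<theta> \<in> X}. ereal t)"

lemma ray_length_eq_emeasure:
  fixes X :: "'a::real_normed_vector set"
  assumes "closed X" "convex X" "p \<in> X"
  shows "ray_length X p \<theta> = enn2ereal (emeasure lborel {t::real. t \<ge> 0 \<and> p + t *\<^sub>R \<theta> \<in> X})"
proof -
  define S where "S = {t::real. t \<ge> 0 \<and> p + t *\<^sub>R \<theta> \<in> X}"
  have S0: "0 \<in> S" and Sge: "\<And>t. t \<in> S \<Longrightarrow> 0 \<le> t" using assms(3) by (auto simp: S_def)
  have "closed ({0..} \<inter> (\<lambda>t::real. p + t *\<^sub>R \<theta>) -` X)"
    by (intro closed_Int closed_atLeast closed_vimage assms(1) continuous_intros)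
  moreover have "S = {0..} \<inter> (\<lambda>t::real. p + t *\<^sub>R \<theta>) -` X" by (auto simp: S_def)
  ultimately have clS: "closed S" by simp
  have down: "s \<in> S" if "t \<in> S" "0 \<le> s" "s \<le> t" for s t
  proof (cases "t = 0")
    case False
    with that have t: "t > 0" by simp
    have "(1 - s / t) *\<^sub>R p + (s / t) *\<^sub>R (p + t *\<^sub>R \<theta>) \<in> X"
      using that t assms by (intro convexD) (auto simp: S_def field_simps)
    moreover have "(1 - s / t) *\<^sub>R p + (s / t) *\<^sub>R (p + t *\<^sub>R \<theta>) = p + s *\<^sub>R \<theta>"
      using t by (simp add: algebra_simps)
    ultimately show ?thesis using that by (simp add: S_def)
  qed (use that S0 in auto)
  have "(SUP t\<in>S. ereal t) = enn2ereal (emeasure lborel S)"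
  proof (cases "bdd_above S")
    case True
    define m where "m = Sup S"
    have mS: "m \<in> S" unfolding m_def using closed_contains_Sup[OF _ True clS] S0 by auto
    have le: "\<And>t. t \<in> S \<Longrightarrow> t \<le> m" unfolding m_def using True by (simp add: cSup_upper)
    have SI: "S = {0..m}" using Sge le down[OF mS] unfolding set_eq_iff atLeastAtMost_iff by blast
    have "(SUP t\<in>S. ereal t) = ereal m"
      by (intro antisym SUP_least SUP_upper mS) (auto simp: le)
    moreover have "enn2ereal (emeasure lborel S) = ereal m"
      using Sge[OF mS] unfolding SI by (simp add: enn2ereal_ennreal)
    ultimately show ?thesis by simp
  next
    case False
    have ex: "\<exists>t\<in>S. B < t" for B using False unfolding bdd_above_def by (metis not_le)
    have "s \<in> S" if "0 \<le> s" for s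
    proof -
      obtain t where "t \<in> S" "s < t" using ex by blast
      then show ?thesis using down[of t s] that by simp
    qed
    then have SI: "S = {0..}" using Sge unfolding set_eq_iff atLeast_iff by blast
    have "(SUP t\<in>S. ereal t) = \<infinity>"
    proof (rule SUP_PInfty)
      fix n :: nat
      show "\<exists>t\<in>S. ereal (real n) \<le> ereal t" using ex[of "real n"] unfolding ereal_less_eq(3) by (blast intro: less_imp_le)
    qed
    moreover have "emeasure lborel {0::real..} = \<infinity>"
    proof -
      have "ennreal (real n) \<le> emeasure lborel {0::real..}" for n :: nat
        using emeasure_mono[of "{0..real n}" "{0::real..}" lborel] by auto
      then have "\<And>n. of_nat n \<le> emeasure lborel {0::real..}"
        by (simp add: ennreal_of_nat_eq_real_of_nat)
      then have "(SUP n. of_nat n :: ennreal) \<le> emeasure lborel {0::real..}"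
        by (intro SUP_least)
      then show ?thesis by (simp add: ennreal_SUP_of_nat_eq_top top_unique)
    qed
    ultimately show ?thesis unfolding SI by simp
  qed
  then show ?thesis by (simp add: ray_length_def S_def)
qed

definition emanation_direction :: "'a::real_normed_vector set \<Rightarrow> 'a \<Rightarrow> 'a \<Rightarrow> bool" where
  "emanation_direction X p \<theta> \<longleftrightarrow>
    (\<forall>\<epsilon>::real. \<epsilon> > 0 \<longrightarrow>
      (\<exists>\<beta>::real. \<beta> > 0 \<and>
        (\<forall>\<phi>\<in>ray_directions X p. norm (\<phi> - \<theta>) < \<beta> \<longrightarrow>
          ray_length X p \<phi> \<ge> ray_length X p \<theta> - ereal \<epsilon>)))"

definition emanation_point :: "'a::real_normed_vector set \<Rightarrow> 'a \<Rightarrow> bool" where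
  "emanation_point X p \<longleftrightarrow> (\<forall>\<theta>\<in>ray_directions X p. emanation_direction X p \<theta>)"

definition emanation_property :: "'a::real_normed_vector set \<Rightarrow> 'a set \<Rightarrow> bool" where
  "emanation_property X C \<longleftrightarrow> (\<forall>p\<in>C. emanation_point X p)"

end

theory Submission
  imports Defs "HOL-Complex_Analysis.Great_Picard"
begin

text \<open>
  Cut the sites and \<open>X\<close> down to finite nets.  For net points \<open>p \<in> P k\<close>, \<open>x \<in> X\<close> place one
  point \<open>z = p + s (x - p)\<close> on the segment, let the \<open>k\<close>-th region consist of \<open>P k\<close> and its
  points \<open>z\<close>, and move each parameter \<open>s \<in> [0,1]\<close> by the difference between the distance of \<open>z\<close>
  to the other regions and \<open>|z - p|\<close>, truncated to \<open>[0,1]\<close>.  This is a continuous self-map of a cube; at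
  a fixed point each \<open>z\<close> is either the end \<open>x\<close> of its segment or equidistant from \<open>p\<close> and the other
  regions.  As the nets are refined, a subsequence of the regions converges in the Hausdorff
  sense, and the limit is a zone diagram.  The nontrivial inclusion rests on strict convexity: a
  point \<open>x\<close> of the dominance region outside the limit region would yield a point \<open>w \<noteq> x\<close> of the segment
  from \<open>x\<close> to its nearest site point \<open>p\<close> which is as close to a point \<open>a\<close> of another region as to \<open>p\<close>;
  then \<open>a = p\<close>, so two sites would meet.
\<close>

section \<open>Fixed points in the Hilbert cube\<close>

lemma tendsto_fun_coordinatewise:
  fixes f :: "'b \<Rightarrow> 'i \<Rightarrow> 'a::topological_space"
  assumes "\<And>i. ((\<lambda>n. f n i) \<longlongrightarrow> l i) F"
  shows "(f \<longlongrightarrow> l) F"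
  using assms limitin_componentwise[of "\<lambda>_. euclidean" UNIV f l F]
  by (simp add: euclidean_product_topology)

text \<open>Kuhn's combinatorial lemma on grids in the first \<open>n\<close> coordinates yields
  points near which each of these coordinates is pushed weakly both ways; a coordinatewise
  subsequential limit of such points is fixed. Sequences serve all finite dimensions at once, so the
  number of active parameters need not be encoded in a type.\<close>

lemma Hilbert_cube_fixed_point:
  fixes f :: "(nat \<Rightarrow> real) \<Rightarrow> nat \<Rightarrow> real"
  defines "C \<equiv> {s. \<forall>i. 0 \<le> s i \<and> s i \<le> 1}"
  assumes cont: "continuous_on C f" and maps: "f ` C \<subseteq> C"
  shows "\<exists>s\<in>C. f s = s"
proof -
  \<comment> \<open>Grid of mesh \<open>1 / n\<close> in the first \<open>n\<close> coordinates,
    zero elsewhere; the \<open>min\<close> keeps the point in the cube for arbitrary natural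
    arguments.\<close>
  define pt :: "nat \<Rightarrow> (nat \<Rightarrow> nat) \<Rightarrow> nat \<Rightarrow> real"
    where "pt n x i = (if i < n then min 1 (real (x i) / real n) else 0)" for n x i
  have ptC: "pt n x \<in> C" for n x
    by (auto simp: C_def pt_def)
  have fpt: "0 \<le> f (pt n x) i" "f (pt n x) i \<le> 1" for n x i
    using maps ptC[of n x] by (auto simp: C_def)
  \<comment> \<open>A discrete substitute for a zero of the \<open>i\<close>-th displacement
    \<open>f v i - v i\<close>: both weak signs occur within \<open>e\<close> of \<open>u\<close>,
    measured coordinatewise.\<close>
  define crossing where "crossing e i u \<longleftrightarrow> (\<exists>v\<in>C. \<exists>w\<in>C.
      (\<forall>j. \<bar>v j - u j\<bar> \<le> e \<and> \<bar>w j - u j\<bar> \<le> e) \<and> v i \<le> f v i \<and> f w i \<le> w i)"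
    for e and i :: nat and u :: "nat \<Rightarrow> real"
  have grid: "\<exists>u\<in>C. \<forall>i<n. crossing (1 / n) i u" if "0 < n" for n :: nat
  proof -
    \<comment> \<open>Label 0 excludes downward motion, label 1 excludes upward motion. The faces
      \<open>x i = 0\<close> and \<open>x i = n\<close> get the labels that Kuhn's lemma prescribes,
      which is consistent because \<open>f\<close> maps into the cube.\<close>
    define label :: "(nat \<Rightarrow> nat) \<Rightarrow> nat \<Rightarrow> nat"
      where "label x i = (if x i = n \<or> x i \<noteq> 0 \<and> f (pt n x) i < pt n x i then 1 else 0)" for x i
    have close: "\<bar>pt n r j - pt n q j\<bar> \<le> 1 / n"
      if "\<forall>j<n. q j \<le> r j \<and> r j \<le> q j + 1" for q r j
    proof (cases "j < n")
      case True
      then have "real (q j) / n \<le> real (r j) / n" "real (r j) / n \<le> real (q j) / n + 1 / n"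
        using that[rule_format, of j] \<open>0 < n\<close>
        by (auto simp: divide_right_mono add_divide_distrib[symmetric])
      moreover have "\<bar>min 1 b - min 1 a\<bar> \<le> c" if "a \<le> b" "b \<le> a + c" for a b c :: real
        using that by linarith
      ultimately show ?thesis using True by (simp add: pt_def)
    qed (simp add: pt_def)
    have lab0: "pt n x i \<le> f (pt n x) i" if "label x i = 0" for x i
      using that fpt[of n x i] by (auto simp: label_def pt_def split: if_splits)
    have lab1: "f (pt n x) i \<le> pt n x i" if "label x i \<noteq> 0" "i < n" for x i
      using that fpt[of n x i] by (auto simp: label_def pt_def split: if_splits)
    obtain q where q: "\<forall>i<n. q i < n"
      "\<forall>i<n. \<exists>r s. (\<forall>j<n. q j \<le> r j \<and> r j \<le> q j + 1) \<and> (\<forall>j<n. q j \<le> s j \<and> s j \<le> q j + 1)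
        \<and> label r i \<noteq> label s i"
      by (rule kuhn_lemma[of n n label]) (use \<open>0 < n\<close> in \<open>auto simp: label_def\<close>)
    show ?thesis
    proof (rule bexI[OF _ ptC[of n q]], intro allI impI)
      fix i assume i: "i < n"
      obtain r s where rs: "\<forall>j<n. q j \<le> r j \<and> r j \<le> q j + 1" "\<forall>j<n. q j \<le> s j \<and> s j \<le> q j + 1"
        "label r i \<noteq> label s i"
        using q(2) i by blast
      show "crossing (1 / n) i (pt n q)"
      \<comment> \<open>Of the two differently labelled grid points, the one with label 0 is the
        upward witness and the other the downward one.\<close>
      proof (cases "label r i = 0")
        case True
        then show ?thesis
          using rs i unfolding crossing_def
          by - (rule bexI[OF _ ptC[of n r]], rule bexI[OF _ ptC[of n s]], auto intro!: close lab0 lab1)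
      next
        case False
        then have "label s i = 0" using rs(3) by (auto simp: label_def split: if_splits)
        then show ?thesis
          using rs i False unfolding crossing_def
          by - (rule bexI[OF _ ptC[of n s]], rule bexI[OF _ ptC[of n r]], auto intro!: close lab0 lab1)
      qed
    qed
  qed
  have "\<exists>u. u \<in> C \<and> (\<forall>i\<le>n. crossing (1 / Suc n) i u)" for n :: nat
    using grid[of "Suc n"] by (auto simp: less_Suc_eq_le)
  then have "\<forall>n::nat. \<exists>u. u \<in> C \<and> (\<forall>i\<le>n. crossing (1 / Suc n) i u)" by (rule allI)
  from choice[OF this] obtain u where "\<forall>n. u n \<in> C \<and> (\<forall>i\<le>n. crossing (1 / Suc n) i (u n))"
    by (rule exE)
  then have uC: "u n \<in> C" and u: "i \<le> n \<Longrightarrow> crossing (1 / Suc n) i (u n)" for n i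
    by simp_all
  obtain k l where k: "strict_mono (k :: nat \<Rightarrow> nat)" and l: "\<And>j. (\<lambda>n. u (k n) j) \<longlonglongrightarrow> l j"
  proof -
    have "norm (u n i) \<le> 1" for n i using uC[of n] by (auto simp: C_def)
    then obtain k where k: "strict_mono (k :: nat \<Rightarrow> nat)" "\<And>j. \<exists>l. (\<lambda>n. u (k n) j) \<longlonglongrightarrow> l"
      by - (rule function_convergent_subsequence[of "UNIV :: nat set" u 1], auto)
    from choice[OF allI, OF k(2)] obtain l where "\<forall>j. (\<lambda>n. u (k n) j) \<longlonglongrightarrow> l j"
      by (rule exE)
    then show ?thesis using that[OF k(1), of l] by simp
  qed
  have lC: "l \<in> C"
  proof -
    have "0 \<le> l j" "l j \<le> 1" for j
      using uC by (auto intro!: LIMSEQ_le_const[OF l] LIMSEQ_le_const2[OF l] simp: C_def)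
    then show ?thesis by (simp add: C_def)
  qed
  \<comment> \<open>A crossing in coordinate \<open>i\<close> is known only when
    \<open>i \<le> k n\<close>, hence the guard in the second premise. Under it \<open>v\<close>
    tends to \<open>l\<close> in the product topology, so continuity of \<open>f\<close>
    applies.\<close>
  have lim: "(\<lambda>n. f (v n) i) \<longlonglongrightarrow> f l i" "(\<lambda>n. v n i) \<longlonglongrightarrow> l i"
    if v: "\<And>n. v n \<in> C" "\<And>n j. i \<le> k n \<Longrightarrow> \<bar>v n j - u (k n) j\<bar> \<le> 1 / Suc (k n)" for v i
  proof -
    have coord: "(\<lambda>n. v n j) \<longlonglongrightarrow> l j" for j
    proof -
      have "(\<lambda>n. v n j - u (k n) j) \<longlonglongrightarrow> 0"
      proof (rule Lim_null_comparison)
        show "\<forall>\<^sub>F n in sequentially. norm (v n j - u (k n) j) \<le> 1 / Suc n"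
          using eventually_ge_at_top[of i]
        proof eventually_elim
          case (elim n)
          have kn: "n \<le> k n" by (rule strict_mono_imp_increasing[OF k])
          have "\<bar>v n j - u (k n) j\<bar> \<le> 1 / Suc (k n)" using elim kn by (intro v(2)) simp
          also have "\<dots> \<le> 1 / Suc n" using kn by (intro divide_left_mono) auto
          finally show ?case by simp
        qed
        show "(\<lambda>n. 1 / real (Suc n)) \<longlonglongrightarrow> 0"
          using LIMSEQ_inverse_real_of_nat by (simp add: inverse_eq_divide)
      qed
      from tendsto_add[OF this l[of j]] show ?thesis by simp
    qed
    then show "(\<lambda>n. v n i) \<longlonglongrightarrow> l i" .
    have "v \<longlonglongrightarrow> l" by (rule tendsto_fun_coordinatewise) (rule coord)
    then have "(\<lambda>n. f (v n)) \<longlonglongrightarrow> f l"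
      by (rule continuous_on_tendsto_compose[OF cont _ lC]) (simp add: v(1))
    moreover have "isCont (\<lambda>g::nat \<Rightarrow> real. g i) (f l)"
      using continuous_on_product_coordinates[of i] continuous_on_eq_continuous_at[OF open_UNIV] by blast
    ultimately show "(\<lambda>n. f (v n) i) \<longlonglongrightarrow> f l i"
      using isCont_tendsto_compose by blast
  qed
  have "f l i = l i" for i
  proof -
    \<comment> \<open>Where \<open>k n < i\<close> there is no crossing; the point \<open>l\<close>
      fills in, so that \<open>v\<close> and \<open>w\<close> become total sequences in the
      cube.\<close>
    have "\<forall>n. \<exists>v w. v \<in> C \<and> w \<in> C \<and> (i \<le> k n \<longrightarrow>
        (\<forall>j. \<bar>v j - u (k n) j\<bar> \<le> 1 / Suc (k n) \<and> \<bar>w j - u (k n) j\<bar> \<le> 1 / Suc (k n)) \<and>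
        v i \<le> f v i \<and> f w i \<le> w i)"
      (is "\<forall>n. ?Q n")
    proof
      fix n
      show "?Q n"
      proof (cases "i \<le> k n")
        case True
        then show ?thesis using u[of i "k n"] unfolding crossing_def by blast
      qed (use lC in blast)
    qed
    from choice[OF this] obtain v where "\<forall>n. \<exists>w. v n \<in> C \<and> w \<in> C \<and> (i \<le> k n \<longrightarrow>
        (\<forall>j. \<bar>v n j - u (k n) j\<bar> \<le> 1 / Suc (k n) \<and> \<bar>w j - u (k n) j\<bar> \<le> 1 / Suc (k n)) \<and>
        v n i \<le> f (v n) i \<and> f w i \<le> w i)"
      by (rule exE)
    from choice[OF this] obtain w where "\<forall>n. v n \<in> C \<and> w n \<in> C \<and> (i \<le> k n \<longrightarrow>
        (\<forall>j. \<bar>v n j - u (k n) j\<bar> \<le> 1 / Suc (k n) \<and> \<bar>w n j - u (k n) j\<bar> \<le> 1 / Suc (k n)) \<and>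
        v n i \<le> f (v n) i \<and> f (w n) i \<le> w n i)"
      by (rule exE)
    then have vw: "v n \<in> C" "w n \<in> C"
       "i \<le> k n \<Longrightarrow> \<bar>v n j - u (k n) j\<bar> \<le> 1 / Suc (k n)"
       "i \<le> k n \<Longrightarrow> \<bar>w n j - u (k n) j\<bar> \<le> 1 / Suc (k n)"
       "i \<le> k n \<Longrightarrow> v n i \<le> f (v n) i"
       "i \<le> k n \<Longrightarrow> f (w n) i \<le> w n i" for n j
      by blast+
    have large: "\<exists>N. \<forall>n\<ge>N. i \<le> k n"
      using order_trans[OF _ strict_mono_imp_increasing[OF k]] by blast
    show ?thesis
    proof (rule antisym)
      show "f l i \<le> l i"
        by (rule LIMSEQ_le[OF lim[OF vw(2,4)]]) (use large vw(6) in blast)+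
      show "l i \<le> f l i"
        by (rule LIMSEQ_le[OF lim(2,1)[OF vw(1,3)]]) (use large vw(5) in blast)+
    qed
  qed
  then show ?thesis using lC by auto
qed

section \<open>Finite approximations of a zone diagram\<close>

text \<open>Each moving point contributes one more minimum of continuous functions. The fixed
  nonempty part \<open>Q\<close> starts the recursion, since \<open>infdist\<close> to the empty set
  is 0 by convention.\<close>

lemma continuous_on_infdist_Un_image:
  assumes "finite I" and "Q \<noteq> {}" and "\<And>i. i \<in> I \<Longrightarrow> continuous_on S (g i)"
    and "continuous_on S y"
  shows "continuous_on S (\<lambda>s. infdist (y s) (Q \<union> (\<lambda>i. g i s) ` I))"
  using assms(1,3)
proof (induction I rule: finite_induct)
  case empty
  then show ?case using assms(4) by (auto intro: continuous_intros)
next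
  case (insert i I)
  have eq: "infdist (y s) (Q \<union> (\<lambda>i. g i s) ` insert i I) =
      min (dist (y s) (g i s)) (infdist (y s) (Q \<union> (\<lambda>i. g i s) ` I))" for s
    using infdist_Un_min[of "{g i s}" "Q \<union> (\<lambda>i. g i s) ` I" "y s"] \<open>Q \<noteq> {}\<close> by simp
  show ?case
    unfolding eq using insert assms(4) by (auto intro!: continuous_intros)
qed

text \<open>\<open>T\<close> lists the segments by site index, site point and end point. The second
  conclusion becomes, in the limit, the inclusion of a region in its dominance region; the third
  serves the reverse inclusion: a segment is cut short only where equidistance holds.\<close>

lemma finite_zone_approximation:
  fixes P :: "'k \<Rightarrow> 'a::real_normed_vector set"
  assumes "convex X" and "finite K" and "card K \<ge> 2"
    and Pne: "\<And>k. k \<in> K \<Longrightarrow> P k \<noteq> {}" and PX: "\<And>k. k \<in> K \<Longrightarrow> P k \<subseteq> X"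
    and "finite T" and T: "T \<subseteq> (SIGMA k:K. P k \<times> X)"
  shows "\<exists>R. (\<forall>k\<in>K. P k \<subseteq> R k \<and> R k \<subseteq> X) \<and>
    (\<forall>k\<in>K. \<forall>z\<in>R k. \<exists>p\<in>P k. dist z p \<le> infdist z (\<Union>j\<in>K - {k}. R j)) \<and>
    (\<forall>(k, p, x)\<in>T. \<exists>s\<in>{0..1}. p + s *\<^sub>R (x - p) \<in> R k \<and>
       (s = 1 \<or> dist (p + s *\<^sub>R (x - p)) p = infdist (p + s *\<^sub>R (x - p)) (\<Union>j\<in>K - {k}. R j)))"
proof -
  \<comment> \<open>Numbering the segments turns their parameters into the first \<open>N\<close>
    coordinates of a point of the Hilbert cube; \<open>f\<close> below sets all others to 0.\<close>
  obtain N :: nat and e where e: "T = e ` {i. i < N}"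
    using finite_imp_nat_seg_image_inj_on[OF \<open>finite T\<close>] by metis
  define kk pp xx where "kk i = fst (e i)" and "pp i = fst (snd (e i))" and "xx i = snd (snd (e i))" for i
  have ei: "e i = (kk i, pp i, xx i)" for i
    by (simp add: kk_def pp_def xx_def)
  have mem: "kk i \<in> K" "pp i \<in> P (kk i)" "xx i \<in> X" if "i < N" for i
  proof -
    have "e i \<in> T" using that by (simp add: e)
    then have "e i \<in> (SIGMA k:K. P k \<times> X)" by (rule subsetD[OF T])
    then show "kk i \<in> K" "pp i \<in> P (kk i)" "xx i \<in> X" by (simp_all add: ei)
  qed
  define C :: "(nat \<Rightarrow> real) set" where "C = {s. \<forall>i. 0 \<le> s i \<and> s i \<le> 1}"
  define z where "z s i = pp i + s i *\<^sub>R (xx i - pp i)" for s :: "nat \<Rightarrow> real" and i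
  define R where "R s k = P k \<union> z s ` {i. i < N \<and> kk i = k}" for s k
  define A where "A s k = (\<Union>j\<in>K - {k}. R s j)" for s k
  define g where "g s i = infdist (z s i) (A s (kk i)) - dist (z s i) (pp i)" for s i
  define f where "f s i = (if i < N then max 0 (min 1 (s i + g s i)) else 0)" for s i
  \<comment> \<open>Separates the fixed sites from the moving points, the form in which continuity
    of the distance is available.\<close>
  have A: "A s k = (\<Union>j\<in>K - {k}. P j) \<union> (\<lambda>i. z s i) ` {i. i < N \<and> kk i \<noteq> k}" for s k
    unfolding A_def R_def using mem(1) by blast
  have coord: "continuous_on C (\<lambda>s. s i)" for i
    by (rule continuous_on_subset[OF continuous_on_product_coordinates]) simp
  have z: "continuous_on C (\<lambda>s. z s i)" for i
    unfolding z_def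
    by (intro continuous_on_add continuous_on_scaleR continuous_on_const coord)
  have infdist: "continuous_on C (\<lambda>s. infdist (z s i) (A s k))" if "k \<in> K" for i k
  proof -
    have "K - {k} \<noteq> {}"
    proof
      assume "K - {k} = {}"
      then have "card K \<le> card {k}" by (intro card_mono) auto
      with \<open>card K \<ge> 2\<close> show False by simp
    qed
    then have "(\<Union>j\<in>K - {k}. P j) \<noteq> {}" using Pne by blast
    then show ?thesis unfolding A
      by (intro continuous_on_infdist_Un_image z) auto
  qed
  have "continuous_on C (\<lambda>s. g s i)" if "i < N" for i
    unfolding g_def
    by (intro continuous_on_diff continuous_on_dist continuous_on_const infdist z mem(1) that)
  then have "continuous_on C (\<lambda>s. f s i)" for i
    unfolding f_def
    by (cases "i < N")
      (simp_all add: continuous_on_max continuous_on_min continuous_on_add coord)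
  then have "continuous_on C f" by (rule continuous_on_coordinatewise_then_product)
  moreover have "f ` C \<subseteq> C" by (auto simp: C_def f_def)
  ultimately obtain s where s: "s \<in> C" "f s = s"
    using Hilbert_cube_fixed_point[of f] unfolding C_def by blast
  have zero: "z s i = pp i" if "s i = 0" for i
    using that by (simp add: z_def)
  \<comment> \<open>Truncation at 0 hides no negative displacement: at parameter 0 the point is
    \<open>pp i\<close> itself, so \<open>g s i\<close> is a distance minus 0.\<close>
  have fixed: "g s i = 0 \<or> s i = 1 \<and> 0 \<le> g s i" if "i < N" for i
  proof -
    have "max 0 (min 1 (s i + g s i)) = s i"
      using fun_cong[OF s(2), of i] that by (simp add: f_def)
    moreover have "0 \<le> g s i" if "s i = 0"
      using zero[OF that] by (simp add: g_def infdist_nonneg)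
    ultimately show ?thesis by (auto simp: max_def min_def split: if_splits)
  qed
  have "z s i \<in> X" if "i < N" for i
  proof -
    have "(1 - s i) *\<^sub>R pp i + s i *\<^sub>R xx i \<in> X"
      using mem[OF that] PX s(1) by (intro convexD[OF \<open>convex X\<close>]) (auto simp: C_def)
    then show ?thesis by (simp add: z_def algebra_simps)
  qed
  then have "P k \<subseteq> R s k \<and> R s k \<subseteq> X" if "k \<in> K" for k
    using PX[OF that] by (auto simp: R_def)
  \<comment> \<open>A site point is its own witness; for a segment point the start
    \<open>pp i\<close> works, because \<open>g s i\<close> is nonnegative at the fixed
    point.\<close>
  moreover have "\<exists>p\<in>P k. dist y p \<le> infdist y (\<Union>j\<in>K - {k}. R s j)" if "k \<in> K" "y \<in> R s k" for k y
  proof (cases "y \<in> P k")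
    case True
    then show ?thesis by (intro bexI[of _ y]) (auto simp: infdist_nonneg)
  next
    case False
    then obtain i where i: "i < N" "kk i = k" "y = z s i" using \<open>y \<in> R s k\<close> by (auto simp: R_def)
    then show ?thesis
      using mem[of i] fixed[of i] by (intro bexI[of _ "pp i"]) (auto simp: g_def A_def)
  qed
  moreover have "\<exists>t\<in>{0..1}. p + t *\<^sub>R (x - p) \<in> R s k \<and>
       (t = 1 \<or> dist (p + t *\<^sub>R (x - p)) p = infdist (p + t *\<^sub>R (x - p)) (\<Union>j\<in>K - {k}. R s j))"
    if kpx: "(k, p, x) \<in> T" for k p x
  proof -
    obtain i where i: "i < N" "kk i = k" "pp i = p" "xx i = x" using kpx ei unfolding e by auto
    then have "z s i = p + s i *\<^sub>R (x - p)" by (simp add: z_def)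
    moreover have "z s i \<in> R s k" using i by (auto simp: R_def)
    ultimately show ?thesis
      using fixed[OF i(1)] i s(1) by (intro bexI[of _ "s i"]) (auto simp: g_def A_def C_def)
  qed
  ultimately show ?thesis by (intro exI[of _ "R s"]) auto
qed

section \<open>Strict convexity\<close>

text \<open>Equality in the triangle inequality passes to the normalised vectors; their midpoint
  then has norm at least 1, which uniform convexity forbids unless they coincide. The form without
  division also covers zero vectors.\<close>

lemma uniformly_convex_triangle_eq:
  fixes u v :: "'a::real_normed_vector"
  assumes uc: "uniformly_convex_space TYPE('a)" and eq: "norm (u + v) = norm u + norm v"
  shows "norm u *\<^sub>R v = norm v *\<^sub>R u"
proof -
  have *: "sgn u = sgn v"
    if le: "norm u \<le> norm v" and u: "u \<noteq> 0" and eq: "norm (u + v) = norm u + norm v" for u v :: 'a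
  proof (rule ccontr)
    assume ne: "sgn u \<noteq> sgn v"
    have pos: "0 < norm u" "0 < norm v" using u le by auto
    define c where "c = norm v / norm u"
    have c: "1 \<le> c" "c * norm u = norm v" using pos le by (auto simp: c_def)
    \<comment> \<open>Here \<open>u\<close> is stretched to the length of \<open>v\<close>. By the
      reverse triangle inequality the right side has norm at least
      \<open>c * norm u + norm v\<close>, which is \<open>2 * norm v\<close>.\<close>
    have "norm v *\<^sub>R (sgn u + sgn v) = c *\<^sub>R (u + v) - (c - 1) *\<^sub>R v"
      using pos by (simp add: sgn_div_norm c_def algebra_simps divide_inverse)
    then have "norm (c *\<^sub>R (u + v)) - norm ((c - 1) *\<^sub>R v) \<le> norm (norm v *\<^sub>R (sgn u + sgn v))"
      using norm_triangle_ineq2[of "c *\<^sub>R (u + v)" "(c - 1) *\<^sub>R v"] by simp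
    then have "c * (norm u + norm v) - (c - 1) * norm v \<le> norm v * norm (sgn u + sgn v)"
      using c by (simp add: eq)
    then have "norm v * 2 \<le> norm v * norm (sgn u + sgn v)" using c by (simp add: algebra_simps)
    then have two: "2 \<le> norm (sgn u + sgn v)" using pos by simp
    have unit: "norm (sgn u) = 1" "norm (sgn v) = 1" using pos by (auto simp: norm_sgn)
    \<comment> \<open>The distance between the two unit vectors is itself an admissible
      \<epsilon>.\<close>
    have "norm (sgn u - sgn v) \<le> 2" using norm_triangle_ineq4[of "sgn u" "sgn v"] unit by simp
    moreover have "0 < norm (sgn u - sgn v)" using ne by simp
    ultimately obtain \<delta> where "0 < \<delta>" "norm ((1 / 2) *\<^sub>R (sgn u + sgn v)) \<le> 1 - \<delta>"
      using uc unit unfolding uniformly_convex_space_def by blast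
    then show False using two by simp
  qed
  show ?thesis
  proof (cases "u = 0 \<or> v = 0")
    case False
    then have "sgn u = sgn v"
      using *[of u v] *[of v u] eq by (cases "norm u \<le> norm v") (auto simp: add.commute)
    then have "norm v *\<^sub>R norm u *\<^sub>R sgn u = norm u *\<^sub>R norm v *\<^sub>R sgn v"
      by (simp add: mult.commute)
    then show ?thesis using False by (simp add: sgn_div_norm)
  qed auto
qed

text \<open>The chain \<open>dist x a \<le> dist x z + dist z a = dist x p \<le> dist x a\<close>
  forces equality, so \<open>z - a\<close> and \<open>z - p\<close> are both nonnegative multiples
  of \<open>x - z\<close>; having equal length, they agree.\<close>

lemma uniformly_convex_nearest_unique:
  fixes x z p a :: "'a::real_normed_vector"
  assumes uc: "uniformly_convex_space TYPE('a)"
    and "dist x p = dist x z + dist z p" and "dist z a = dist z p" and "dist x p \<le> dist x a" and "x \<noteq> z"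
  shows "a = p"
proof -
  have "dist x a \<le> dist x z + dist z a" by (rule dist_triangle)
  then have "norm ((x - z) + (z - a)) = norm (x - z) + norm (z - a)"
    "norm ((x - z) + (z - p)) = norm (x - z) + norm (z - p)"
    using assms by (simp_all add: dist_norm)
  from this[THEN uniformly_convex_triangle_eq[OF uc]]
  have "norm (x - z) *\<^sub>R (z - a) = norm (x - z) *\<^sub>R (z - p)"
    using assms by (simp add: dist_norm)
  then show ?thesis using \<open>x \<noteq> z\<close> by simp
qed

section \<open>Nets, distance functions and Hausdorff limits\<close>

lemma compact_finite_nets:
  fixes S :: "'a::metric_space set"
  assumes "compact S"
  obtains F :: "nat \<Rightarrow> 'a set" where "\<And>n. finite (F n)" "\<And>n. F n \<subseteq> S"
    "\<And>n x. x \<in> S \<Longrightarrow> \<exists>y\<in>F n. dist y x < 1 / Suc n"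
proof -
  have "\<exists>k. finite k \<and> k \<subseteq> S \<and> S \<subseteq> (\<Union>x\<in>k. ball x (1 / Suc n))" for n
    using seq_compact_imp_totally_bounded[OF compact_imp_seq_compact[OF assms]] by simp
  from choice[OF allI, OF this] obtain F
    where F: "\<forall>n. finite (F n) \<and> F n \<subseteq> S \<and> S \<subseteq> (\<Union>x\<in>F n. ball x (1 / Suc n))"
    by (rule exE)
  show ?thesis
  proof (rule that)
    fix n x assume "x \<in> S"
    then have "x \<in> (\<Union>y\<in>F n. ball y (1 / Suc n))" using F by blast
    then show "\<exists>y\<in>F n. dist y x < 1 / Suc n" by simp
  qed (use F in simp_all)
qed

lemma infdist_attained:
  assumes "compact S" and "S \<noteq> {}"
  obtains a where "a \<in> S" "infdist x S = dist x a"
proof -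
  have "continuous_on S (\<lambda>y. dist x y)" by (intro continuous_intros)
  from continuous_attains_inf[OF assms this]
  obtain a where a: "a \<in> S" "\<And>b. b \<in> S \<Longrightarrow> dist x a \<le> dist x b"
    by blast
  then have "dist x a \<le> infdist x S"
    using assms(2) by (auto simp: infdist_notempty intro: cINF_greatest)
  then show ?thesis using that[OF a(1)] infdist_le[OF a(1), of x] by simp
qed

lemma infdist_approached:
  assumes "S \<noteq> {}" and "0 < e"
  obtains a where "a \<in> S" "dist x a < infdist x S + e"
proof -
  have "\<exists>a\<in>S. dist x a < infdist x S + e"
  proof (rule ccontr)
    assume "\<not> ?thesis"
    then have "infdist x S + e \<le> dist x a" if "a \<in> S" for a using that by (simp add: not_less)
    then have "infdist x S + e \<le> infdist x S"
      unfolding infdist_notempty[OF assms(1)] by (rule cINF_greatest[OF assms(1)])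
    with \<open>0 < e\<close> show False by simp
  qed
  then show ?thesis using that by blast
qed

text \<open>Distance functions are 1-Lipschitz whatever the set, so the point and the set may vary
  together.\<close>

lemma tendsto_infdist_moving:
  assumes "(\<lambda>n. infdist y (A n)) \<longlonglongrightarrow> c" and "u \<longlonglongrightarrow> y"
  shows "(\<lambda>n. infdist (u n) (A n)) \<longlonglongrightarrow> c"
proof -
  have "(\<lambda>n. infdist (u n) (A n) - infdist y (A n)) \<longlonglongrightarrow> 0"
  proof (rule Lim_null_comparison)
    show "\<forall>\<^sub>F n in sequentially. norm (infdist (u n) (A n) - infdist y (A n)) \<le> dist (u n) y"
      by (simp add: infdist_triangle_abs)
    show "(\<lambda>n. dist (u n) y) \<longlonglongrightarrow> 0" using assms(2) by (rule tendsto_dist_iff[THEN iffD1])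
  qed
  from tendsto_add[OF this assms(1)] show ?thesis by simp
qed

lemma tendsto_infdist_UN:
  assumes "finite J" and "J \<noteq> {}" and "\<And>j n. j \<in> J \<Longrightarrow> S n j \<noteq> {}" and "\<And>j. j \<in> J \<Longrightarrow> L j \<noteq> {}"
    and "\<And>j. j \<in> J \<Longrightarrow> (\<lambda>n. infdist y (S n j)) \<longlonglongrightarrow> infdist y (L j)"
  shows "(\<lambda>n. infdist y (\<Union>j\<in>J. S n j)) \<longlonglongrightarrow> infdist y (\<Union>j\<in>J. L j)"
  using assms
proof (induction J rule: finite_ne_induct)
  case (insert i J)
  obtain j where j: "j \<in> J" using insert.hyps(2) by blast
  have ne: "(\<Union>j\<in>J. S n j) \<noteq> {}" "(\<Union>j\<in>J. L j) \<noteq> {}" "S n i \<noteq> {}" "L i \<noteq> {}" for n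
    using insert.prems(1)[of j n] insert.prems(2)[of j] j insert.prems(1)[of i n] insert.prems(2)[of i]
    by auto
  have IH: "(\<lambda>n. infdist y (\<Union>j\<in>J. S n j)) \<longlonglongrightarrow> infdist y (\<Union>j\<in>J. L j)"
    by (rule insert.IH) (use insert.prems in simp_all)
  have "(\<lambda>n. infdist y (S n i)) \<longlonglongrightarrow> infdist y (L i)"
    by (rule insert.prems(3)) simp
  from tendsto_min[OF this IH] show ?case
    by (simp add: infdist_Un_min[OF ne(3,1)] infdist_Un_min[OF ne(4,2)])
qed simp

text \<open>Blaschke selection phrased through distance functions: they are bounded by the diameter
  and 1-Lipschitz, so a diagonal choice on a countable dense set suffices, as in the Arzela-Ascoli
  theorem.\<close>

lemma infdist_convergent_subsequence:
  fixes R :: "nat \<Rightarrow> 'k \<Rightarrow> 'a::metric_space set"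
  assumes X: "compact X" and "countable K"
    and R: "\<And>n k. k \<in> K \<Longrightarrow> R n k \<noteq> {} \<and> R n k \<subseteq> X"
  obtains r where "strict_mono (r :: nat \<Rightarrow> nat)"
    "\<And>k y. k \<in> K \<Longrightarrow> y \<in> X \<Longrightarrow> convergent (\<lambda>n. infdist y (R (r n) k))"
proof -
  obtain F where F: "\<And>n. finite (F n)" "\<And>n. F n \<subseteq> X"
    "\<And>n x. x \<in> X \<Longrightarrow> \<exists>y\<in>F n. dist y x < 1 / Suc n"
    by (rule compact_finite_nets[OF X]) blast
  define D where "D = (\<Union>n. F n)"
  have "countable D" using F(1) by (auto simp: D_def intro: countable_finite)
  have bd: "norm (infdist y (R n k)) \<le> diameter X" if k: "k \<in> K" and y: "y \<in> D" for k y n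
  proof -
    obtain a where "a \<in> R n k" using R[OF k] by blast
    moreover have "y \<in> X" using y F(2) by (auto simp: D_def)
    ultimately have "infdist y (R n k) \<le> diameter X"
      using R[OF k] diameter_bounded_bound[OF compact_imp_bounded[OF X]]
      by (meson infdist_le2 subsetD)
    then show ?thesis by (simp add: infdist_nonneg)
  qed
  obtain r where r: "strict_mono (r :: nat \<Rightarrow> nat)"
    "\<And>ky. ky \<in> K \<times> D \<Longrightarrow> \<exists>l. (\<lambda>n. infdist (snd ky) (R (r n) (fst ky))) \<longlonglongrightarrow> l"
    by (rule function_convergent_subsequence[of "K \<times> D" "\<lambda>n ky. infdist (snd ky) (R n (fst ky))" "diameter X"])
      (use \<open>countable D\<close> \<open>countable K\<close> bd in auto)
  have "Cauchy (\<lambda>n. infdist y (R (r n) k))" if "k \<in> K" "y \<in> X" for k y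
  proof (rule metric_CauchyI)
    fix e :: real assume "0 < e"
    \<comment> \<open>Three-epsilon argument through a net point \<open>w\<close> close to
      \<open>y\<close>.\<close>
    then obtain m where "1 / real (Suc m) < e / 3"
      using nat_approx_posE[of "e / 3"] by auto
    with F(3)[OF that(2), of m] obtain w where w: "w \<in> D" "dist w y < e / 3"
      by (force simp: D_def)
    then have "Cauchy (\<lambda>n. infdist w (R (r n) k))"
      using r(2)[of "(k, w)"] that by (auto intro: LIMSEQ_imp_Cauchy)
    from metric_CauchyD[OF this, of "e / 3"] \<open>0 < e\<close>
    obtain M where M: "\<And>m n. m \<ge> M \<Longrightarrow> n \<ge> M \<Longrightarrow>
        dist (infdist w (R (r m) k)) (infdist w (R (r n) k)) < e / 3"
      by auto
    have "dist (infdist y (R (r m) k)) (infdist y (R (r n) k)) < e" if "m \<ge> M" "n \<ge> M" for m n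
      using M[OF that] w(2) infdist_triangle_abs[of w "R (r m) k" y] infdist_triangle_abs[of w "R (r n) k" y]
      unfolding dist_real_def by linarith
    then show "\<exists>M. \<forall>m\<ge>M. \<forall>n\<ge>M. dist (infdist y (R (r m) k)) (infdist y (R (r n) k)) < e"
      by blast
  qed
  then show ?thesis using that[OF r(1)] by (simp add: Cauchy_convergent_iff)
qed

text \<open>A pointwise limit of distance functions on a compact set is again a distance function,
  that of its zero set; thus \<open>L\<close> is the Hausdorff limit of the sets.\<close>

lemma infdist_limit_set:
  fixes S :: "nat \<Rightarrow> 'a::metric_space set"
  assumes X: "compact X" and S: "\<And>n. S n \<noteq> {}" "\<And>n. S n \<subseteq> X" and "X \<noteq> {}"
    and conv: "\<And>y. y \<in> X \<Longrightarrow> convergent (\<lambda>n. infdist y (S n))"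
  defines "L \<equiv> {x \<in> X. (\<lambda>n. infdist x (S n)) \<longlonglongrightarrow> 0}"
  shows "compact L" and "L \<noteq> {}" and "\<And>y. y \<in> X \<Longrightarrow> (\<lambda>n. infdist y (S n)) \<longlonglongrightarrow> infdist y L"
proof -
  define f where "f y = lim (\<lambda>n. infdist y (S n))" for y
  have f: "(\<lambda>n. infdist y (S n)) \<longlonglongrightarrow> f y" if "y \<in> X" for y
    using conv[OF that] by (simp add: f_def convergent_LIMSEQ_iff)
  have lip: "f y \<le> f z + dist y z" if "y \<in> X" "z \<in> X" for y z
    by (rule LIMSEQ_le[OF f[OF that(1)] tendsto_add[OF f[OF that(2)] tendsto_const]])
      (auto intro: infdist_triangle)
  have L: "L = {x \<in> X. f x = 0}"
  proof -
    have "(\<lambda>n. infdist x (S n)) \<longlonglongrightarrow> 0 \<longleftrightarrow> f x = 0" if "x \<in> X" for x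
      using f[OF that] LIMSEQ_unique[OF f[OF that], of 0] by auto
    then show ?thesis unfolding L_def by blast
  qed
  have "continuous_on X f"
    unfolding continuous_on_iff
  proof (intro ballI allI impI)
    fix x and e :: real assume "x \<in> X" "0 < e"
    then have "dist (f y) (f x) < e" if "y \<in> X" "dist y x < e" for y
      using lip[of x y] lip[of y x] that by (auto simp: dist_real_def dist_commute)
    then show "\<exists>d>0. \<forall>y\<in>X. dist y x < d \<longrightarrow> dist (f y) (f x) < e" using \<open>0 < e\<close> by blast
  qed
  then have "closed L"
    unfolding L by (rule continuous_closed_preimage_constant) (simp add: X compact_imp_closed)
  then have "compact (X \<inter> L)" by (rule compact_Int_closed[OF X])
  moreover have "X \<inter> L = L" by (auto simp: L_def)
  ultimately show "compact L" by simp
  \<comment> \<open>Almost nearest points of \<open>S n\<close> to \<open>y\<close> accumulate at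
    some \<open>b\<close>. Since they lie in the sets, \<open>f b = 0\<close>, and their distances
    to \<open>y\<close> give \<open>dist y b \<le> f y\<close>.\<close>
  have near: "\<exists>a\<in>L. dist y a \<le> f y" if "y \<in> X" for y
  proof -
    have "\<exists>a\<in>S n. dist y a < infdist y (S n) + 1 / Suc n" for n
      using infdist_approached[OF S(1)[of n], of "1 / real (Suc n)" y] by auto
    then have "\<forall>n. \<exists>a. a \<in> S n \<and> dist y a < infdist y (S n) + 1 / Suc n" by blast
    from choice[OF this] obtain a
      where a: "a n \<in> S n" "dist y (a n) < infdist y (S n) + 1 / Suc n" for n
      by blast
    then obtain b r where b: "b \<in> X" "strict_mono r" "(a \<circ> r) \<longlonglongrightarrow> b"
      using X[unfolded compact_def, rule_format, of a, OF subsetD[OF S(2) a(1)]] by blast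
    have "(\<lambda>n. infdist b (S (r n))) \<longlonglongrightarrow> 0"
    proof (rule Lim_null_comparison)
      show "\<forall>\<^sub>F n in sequentially. norm (infdist b (S (r n))) \<le> dist (a (r n)) b"
        using infdist_le[OF a(1)] by (simp add: infdist_nonneg dist_commute)
      show "(\<lambda>n. dist (a (r n)) b) \<longlonglongrightarrow> 0" using tendsto_dist_iff[THEN iffD1, OF b(3)] by (simp add: o_def)
    qed
    moreover have "(\<lambda>n. infdist b (S (r n))) \<longlonglongrightarrow> f b"
      using LIMSEQ_subseq_LIMSEQ[OF f[OF b(1)] b(2)] by (simp add: o_def)
    ultimately have "b \<in> L" using b(1) LIMSEQ_unique unfolding L by blast
    have "(\<lambda>n. infdist y (S n) + 1 / Suc n) \<longlonglongrightarrow> f y + 0"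
      by (intro tendsto_add f that LIMSEQ_Suc lim_inverse_n')
    then have "(\<lambda>n. infdist y (S (r n)) + 1 / Suc (r n)) \<longlonglongrightarrow> f y"
      using LIMSEQ_subseq_LIMSEQ[OF _ b(2), of "\<lambda>n. infdist y (S n) + 1 / Suc n"] by (simp add: o_def)
    moreover have "(\<lambda>n. dist y (a (r n))) \<longlonglongrightarrow> dist y b"
      using b(3) by (auto intro: tendsto_intros simp: o_def)
    ultimately have "dist y b \<le> f y"
      using a(2) by (intro LIMSEQ_le[of _ "dist y b" _ "f y"]) (auto intro: less_imp_le)
    then show ?thesis using \<open>b \<in> L\<close> by blast
  qed
  then show "L \<noteq> {}" using \<open>X \<noteq> {}\<close> by blast
  have "infdist y L = f y" if "y \<in> X" for y
  proof (rule antisym)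
    show "infdist y L \<le> f y" using near[OF that] infdist_le2 by blast
    \<comment> \<open>\<open>f\<close> is 1-Lipschitz and vanishes on \<open>L\<close>.\<close>
    show "f y \<le> infdist y L"
      using \<open>L \<noteq> {}\<close> lip[OF that] by (auto simp: infdist_notempty L intro!: cINF_greatest) force
  qed
  then show "(\<lambda>n. infdist y (S n)) \<longlonglongrightarrow> infdist y L" if "y \<in> X" for y
    using f[OF that] that by simp
qed

section \<open>The limit of the approximations is a zone diagram\<close>

theorem theorem7p2:
  fixes X :: "'a::real_normed_vector set"
    and K :: "'k set"
    and P :: "'k \<Rightarrow> 'a set"
  assumes "uniformly_convex_space TYPE('a)"
    and "compact X" and "convex X"
    and "finite K" and "card K \<ge> 2"
    and "\<And>k. k \<in> K \<Longrightarrow> P k \<noteq> {}"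
    and "\<And>k. k \<in> K \<Longrightarrow> P k \<subseteq> X"
    and "\<And>k. k \<in> K \<Longrightarrow> compact (P k)"
    and "disjoint_family_on P K"
    and "\<And>k. k \<in> K \<Longrightarrow> emanation_property X (P k)"
  shows "\<exists>R :: 'k \<Rightarrow> 'a set. zone_diagram X K P R"
proof -
  note X = \<open>compact X\<close>
  note P = assms(6,7,8)
  \<comment> \<open>Every site has a rival, so no union of rival regions is empty and no
    \<open>infdist\<close> takes its default value 0.\<close>
  have others: "K - {k} \<noteq> {}" for k
  proof
    assume "K - {k} = {}"
    then have "card K \<le> card {k}" by (intro card_mono) auto
    with \<open>card K \<ge> 2\<close> show False by simp
  qed
  obtain k0 where "k0 \<in> K" using others by blast
  from P(1,2)[OF this] have "X \<noteq> {}" by blast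
  obtain F where F: "\<And>n. finite (F n)" "\<And>n. F n \<subseteq> X"
    "\<And>n x. x \<in> X \<Longrightarrow> \<exists>y\<in>F n. dist y x < 1 / Suc n"
    by (rule compact_finite_nets[OF X]) blast
  have "\<exists>G. \<forall>n. finite (G n) \<and> G n \<subseteq> P k \<and> (\<forall>p\<in>P k. \<exists>q\<in>G n. dist q p < 1 / Suc n)"
    if k: "k \<in> K" for k
  proof -
    obtain G where "\<And>n. finite (G n)" "\<And>n. G n \<subseteq> P k"
      "\<And>n p. p \<in> P k \<Longrightarrow> \<exists>q\<in>G n. dist q p < 1 / Suc n"
      by (rule compact_finite_nets[OF P(3)[OF k]]) blast
    then show ?thesis by (intro exI[of _ G]) simp
  qed
  then have "\<forall>k\<in>K. \<exists>G. \<forall>n. finite (G n) \<and> G n \<subseteq> P k \<and> (\<forall>p\<in>P k. \<exists>q\<in>G n. dist q p < 1 / Suc n)"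
    by simp
  from bchoice[OF this] obtain G where
    "\<forall>k\<in>K. \<forall>n. finite (G k n) \<and> G k n \<subseteq> P k \<and> (\<forall>p\<in>P k. \<exists>q\<in>G k n. dist q p < 1 / Suc n)"
    by (rule exE)
  then have G: "\<And>k n. k \<in> K \<Longrightarrow> finite (G k n) \<and> G k n \<subseteq> P k"
    "\<And>k n p. k \<in> K \<Longrightarrow> p \<in> P k \<Longrightarrow> \<exists>q\<in>G k n. dist q p < 1 / Suc n"
    by simp_all
  define stage where "stage n R \<longleftrightarrow> (\<forall>k\<in>K. P k \<subseteq> R k \<and> R k \<subseteq> X) \<and>
    (\<forall>k\<in>K. \<forall>z\<in>R k. \<exists>p\<in>P k. dist z p \<le> infdist z (\<Union>j\<in>K - {k}. R j)) \<and>
    (\<forall>(k, p, x)\<in>(SIGMA k:K. G k n \<times> F n). \<exists>s\<in>{0..1}. p + s *\<^sub>R (x - p) \<in> R k \<and>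
       (s = 1 \<or> dist (p + s *\<^sub>R (x - p)) p = infdist (p + s *\<^sub>R (x - p)) (\<Union>j\<in>K - {k}. R j)))"
    for n R
  have "\<exists>R. stage n R" for n
    unfolding stage_def
  proof (rule finite_zone_approximation[OF \<open>convex X\<close> \<open>finite K\<close> \<open>card K \<ge> 2\<close> P(1,2)])
    show "finite (SIGMA k:K. G k n \<times> F n)"
      by (intro finite_SigmaI finite_cartesian_product \<open>finite K\<close> F(1)) (simp add: G(1))
    show "(SIGMA k:K. G k n \<times> F n) \<subseteq> (SIGMA k:K. P k \<times> X)"
      by (intro Sigma_mono order_refl F(2)) (simp add: G(1))
  qed
  then have "\<forall>n. \<exists>R. stage n R" by simp
  from choice[OF this] obtain R0 where stage: "\<And>n. stage n (R0 n)" by auto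
  have R0: "P k \<subseteq> R0 n k \<and> R0 n k \<subseteq> X"
    "z \<in> R0 n k \<Longrightarrow> \<exists>p\<in>P k. dist z p \<le> infdist z (\<Union>j\<in>K - {k}. R0 n j)"
    "p \<in> G k n \<Longrightarrow> x \<in> F n \<Longrightarrow> \<exists>s\<in>{0..1}. p + s *\<^sub>R (x - p) \<in> R0 n k \<and>
       (s = 1 \<or> dist (p + s *\<^sub>R (x - p)) p = infdist (p + s *\<^sub>R (x - p)) (\<Union>j\<in>K - {k}. R0 n j))"
    if "k \<in> K" for n k z p x
    using stage[of n] that unfolding stage_def by (auto simp: split_beta)
  have R0ne: "R0 n k \<noteq> {} \<and> R0 n k \<subseteq> X" if "k \<in> K" for n k
    using R0(1)[OF that, of n] P(1)[OF that] by blast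
  obtain r where r: "strict_mono (r :: nat \<Rightarrow> nat)"
    "\<And>k y. k \<in> K \<Longrightarrow> y \<in> X \<Longrightarrow> convergent (\<lambda>n. infdist y (R0 (r n) k))"
  proof (rule infdist_convergent_subsequence[OF X countable_finite[OF \<open>finite K\<close>], where R = R0])
    show "R0 n k \<noteq> {} \<and> R0 n k \<subseteq> X" if "k \<in> K" for n k by (rule R0ne[OF that])
  qed blast
  define R where "R n = R0 (r n)" for n
  define A where "A n k = (\<Union>j\<in>K - {k}. R n j)" for n k
  have Rne: "R n k \<noteq> {}" if "k \<in> K" for n k
    using R0ne[OF that] by (simp add: R_def)
  have PR: "P k \<subseteq> R n k" "R n k \<subseteq> X" if "k \<in> K" for n k
    using R0(1)[OF that] by (auto simp: R_def)
  \<comment> \<open>Since \<open>n \<le> r n\<close>, the nets behind \<open>R n\<close> have mesh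
    at most \<open>1 / Suc n\<close>; net points near \<open>p\<close> and \<open>x\<close> span the
    segment.\<close>
  have ray: "\<exists>q y s. s \<in> {0..1} \<and> dist q p < 1 / Suc n \<and> dist y x < 1 / Suc n \<and>
       q + s *\<^sub>R (y - q) \<in> R n k \<and>
       (s = 1 \<or> dist (q + s *\<^sub>R (y - q)) q = infdist (q + s *\<^sub>R (y - q)) (A n k))"
    if k: "k \<in> K" and p: "p \<in> P k" and x: "x \<in> X" for k p x n
  proof -
    obtain q where q: "q \<in> G k (r n)" "dist q p < 1 / Suc (r n)" using G(2)[OF k p] by blast
    obtain y where y: "y \<in> F (r n)" "dist y x < 1 / Suc (r n)" using F(3)[OF x] by blast
    have "1 / Suc (r n) \<le> 1 / Suc n"
      using strict_mono_imp_increasing[OF r(1), of n] by (intro divide_left_mono) auto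
    then show ?thesis
      using R0(3)[OF k q(1) y(1)] less_le_trans[OF q(2)] less_le_trans[OF y(2)]
      unfolding R_def A_def by blast
  qed
  define L where "L k = {x \<in> X. (\<lambda>n. infdist x (R n k)) \<longlonglongrightarrow> 0}" for k
  have L: "compact (L k)" "L k \<noteq> {}" "\<And>y. y \<in> X \<Longrightarrow> (\<lambda>n. infdist y (R n k)) \<longlonglongrightarrow> infdist y (L k)"
    if "k \<in> K" for k
    using infdist_limit_set[OF X Rne[OF that] PR(2)[OF that] \<open>X \<noteq> {}\<close>] r(2)[OF that]
    unfolding L_def R_def by auto
  have LX: "L k \<subseteq> X" for k by (auto simp: L_def)
  have PL: "P k \<subseteq> L k" if "k \<in> K" for k
  proof
    fix x assume "x \<in> P k"
    moreover from this have "infdist x (R n k) = 0" for n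
      using PR(1)[OF that, of n] by auto
    ultimately show "x \<in> L k" using P(2)[OF that] by (auto simp: L_def)
  qed
  define B where "B k = (\<Union>j\<in>K - {k}. L j)" for k
  have B: "compact (B k)" "B k \<noteq> {}" for k
    unfolding B_def using \<open>finite K\<close> others[of k] L(1,2) by (auto intro!: compact_UN)
  have AB: "(\<lambda>n. infdist y (A n k)) \<longlonglongrightarrow> infdist y (B k)" if "y \<in> X" for y k
    unfolding A_def B_def
    by (rule tendsto_infdist_UN) (use \<open>finite K\<close> others Rne L that in auto)
  have near: "infdist x (P k) \<le> infdist x (B k)" if k: "k \<in> K" and x: "x \<in> L k" for k x
  proof -
    have "x \<in> X" using x LX by blast
    \<comment> \<open>Passing between \<open>x\<close> and a nearby point \<open>z\<close> of
      \<open>R n k\<close> costs \<open>dist x z\<close> once on each side, hence the factor 2; the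
      error vanishes because \<open>x\<close> is in \<open>L k\<close>.\<close>
    have "infdist x (P k) \<le> infdist x (A n k) + 2 * infdist x (R n k)" for n
    proof (rule field_le_epsilon)
      fix e :: real assume "0 < e"
      then obtain z where z: "z \<in> R n k" "dist x z < infdist x (R n k) + e / 2"
        using infdist_approached[OF Rne[OF k], of "e / 2"] by auto
      obtain p where p: "p \<in> P k" "dist z p \<le> infdist z (A n k)"
        using R0(2)[OF k] z(1) unfolding R_def A_def by blast
      have "infdist x (P k) \<le> dist x z + dist z p"
        using infdist_le[OF p(1), of x] dist_triangle[of x p z] by linarith
      moreover have "infdist z (A n k) \<le> infdist x (A n k) + dist x z"
        using infdist_triangle[of z "A n k" x] by (simp add: dist_commute)
      ultimately show "infdist x (P k) \<le> infdist x (A n k) + 2 * infdist x (R n k) + e"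
        using z(2) p(2) by linarith
    qed
    moreover have "(\<lambda>n. infdist x (A n k) + 2 * infdist x (R n k)) \<longlonglongrightarrow> infdist x (B k) + 2 * 0"
      using x by (intro tendsto_intros AB \<open>x \<in> X\<close>) (simp add: L_def)
    ultimately show ?thesis by (intro LIMSEQ_le_const) auto
  qed
  have far: "x \<in> L k" if k: "k \<in> K" and x: "x \<in> X" "infdist x (P k) \<le> infdist x (B k)" for k x
  proof (rule ccontr)
    assume "x \<notin> L k"
    then have "infdist x (L k) > 0"
      using L(1,2)[OF k] by (intro infdist_pos_not_in_closed compact_imp_closed)
    obtain p where p: "p \<in> P k" "infdist x (P k) = dist x p"
      using infdist_attained[OF P(3,1)[OF k]] by blast
    have "\<forall>n. \<exists>q y s. s \<in> {0..1} \<and> dist q p < 1 / Suc n \<and> dist y x < 1 / Suc n \<and>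
       q + s *\<^sub>R (y - q) \<in> R n k \<and>
       (s = 1 \<or> dist (q + s *\<^sub>R (y - q)) q = infdist (q + s *\<^sub>R (y - q)) (A n k))"
      using ray[OF k p(1) x(1)] by (rule allI)
    from choice[OF this] obtain q where "\<forall>n. \<exists>y s. s \<in> {0..1} \<and> dist (q n) p < 1 / Suc n \<and> dist y x < 1 / Suc n \<and>
       q n + s *\<^sub>R (y - q n) \<in> R n k \<and>
       (s = 1 \<or> dist (q n + s *\<^sub>R (y - q n)) (q n) = infdist (q n + s *\<^sub>R (y - q n)) (A n k))"
      by (rule exE)
    from choice[OF this] obtain y where "\<forall>n. \<exists>s. s \<in> {0..1} \<and> dist (q n) p < 1 / Suc n \<and> dist (y n) x < 1 / Suc n \<and>
       q n + s *\<^sub>R (y n - q n) \<in> R n k \<and>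
       (s = 1 \<or> dist (q n + s *\<^sub>R (y n - q n)) (q n) = infdist (q n + s *\<^sub>R (y n - q n)) (A n k))"
      by (rule exE)
    from choice[OF this] obtain s where "\<forall>n. s n \<in> {0..1} \<and> dist (q n) p < 1 / Suc n \<and> dist (y n) x < 1 / Suc n \<and>
       q n + s n *\<^sub>R (y n - q n) \<in> R n k \<and>
       (s n = 1 \<or> dist (q n + s n *\<^sub>R (y n - q n)) (q n) = infdist (q n + s n *\<^sub>R (y n - q n)) (A n k))"
      by (rule exE)
    then have q: "dist (q n) p < 1 / Suc n" and y: "dist (y n) x < 1 / Suc n"
      and s: "s n \<in> {0..1}" "q n + s n *\<^sub>R (y n - q n) \<in> R n k"
        "s n = 1 \<or> dist (q n + s n *\<^sub>R (y n - q n)) (q n) = infdist (q n + s n *\<^sub>R (y n - q n)) (A n k)"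
      for n
      by blast+
    have lim0: "(\<lambda>n. 1 / real (Suc n)) \<longlonglongrightarrow> 0"
      by (rule LIMSEQ_Suc[OF lim_inverse_n'])
    have to: "u \<longlonglongrightarrow> v" if "\<And>n. dist (u n) v < 1 / Suc n" for u and v :: 'a
    proof (rule tendsto_dist_iff[THEN iffD2], rule Lim_null_comparison[OF _ lim0])
      show "\<forall>\<^sub>F n in sequentially. norm (dist (u n) v) \<le> 1 / real (Suc n)"
        using that by (simp add: less_imp_le del: of_nat_Suc)
    qed
    have qp: "q \<longlonglongrightarrow> p" and yx: "y \<longlonglongrightarrow> x"
      by (rule to, rule q) (rule to, rule y)
    \<comment> \<open>The parameters accumulate at some \<open>t\<close>, so the segment points
      \<open>z n\<close> converge to the point \<open>w\<close> of the segment from \<open>p\<close>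
      to \<open>x\<close>.\<close>
    obtain t h where h: "t \<in> {0..1}" "strict_mono h" "(s \<circ> h) \<longlonglongrightarrow> t"
      using compact_Icc[of "0::real" 1, unfolded compact_def, rule_format, of s, OF s(1)] by blast
    define z where "z n = q (h n) + s (h n) *\<^sub>R (y (h n) - q (h n))" for n
    define w where "w = p + t *\<^sub>R (x - p)"
    have qh: "(\<lambda>n. q (h n)) \<longlonglongrightarrow> p" and yh: "(\<lambda>n. y (h n)) \<longlonglongrightarrow> x" and sh: "(\<lambda>n. s (h n)) \<longlonglongrightarrow> t"
      using LIMSEQ_subseq_LIMSEQ[OF qp h(2)] LIMSEQ_subseq_LIMSEQ[OF yx h(2)] h(3) by (simp_all add: o_def)
    have zw: "z \<longlonglongrightarrow> w"
      unfolding z_def w_def by (intro tendsto_intros qh yh sh)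
    have "w = (1 - t) *\<^sub>R p + t *\<^sub>R x" by (simp add: w_def algebra_simps)
    then have "w \<in> X"
      using convexD[OF \<open>convex X\<close>, of p x "1 - t" t] h(1) p(1) P(2)[OF k] x(1) by auto
    have Rsub: "(\<lambda>n. infdist v (R (h n) k)) \<longlonglongrightarrow> infdist v (L k)"
      and Asub: "(\<lambda>n. infdist v (A (h n) k)) \<longlonglongrightarrow> infdist v (B k)" if "v \<in> X" for v
      using LIMSEQ_subseq_LIMSEQ[OF L(3)[OF k that] h(2)] LIMSEQ_subseq_LIMSEQ[OF AB[OF that] h(2)]
      by (simp_all add: o_def)
    \<comment> \<open>The points \<open>z n\<close> lie in the regions, so \<open>w\<close> has
      distance 0 from \<open>L k\<close>, whereas \<open>x\<close> does not. Hence
      \<open>t \<noteq> 1\<close>, and eventually only the equidistance alternative remains.\<close>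
    have "infdist (z n) (R (h n) k) = 0" for n using s(2)[of "h n"] by (simp add: z_def)
    then have "infdist w (L k) = 0"
      using tendsto_infdist_moving[OF Rsub[OF \<open>w \<in> X\<close>] zw] by (simp add: LIMSEQ_const_iff)
    then have "x \<noteq> w" using \<open>infdist x (L k) > 0\<close> by auto
    have "t \<noteq> 1" using \<open>x \<noteq> w\<close> by (auto simp: w_def)
    then have "\<forall>\<^sub>F n in sequentially. s (h n) \<noteq> 1"
      using tendsto_imp_eventually_ne[OF sh] by blast
    then have ev: "\<forall>\<^sub>F n in sequentially. infdist (z n) (A (h n) k) = dist (z n) (q (h n))"
    proof eventually_elim
      case (elim n)
      then show ?case using s(3)[of "h n"] by (simp add: z_def)
    qed
    have "(\<lambda>n. dist (z n) (q (h n))) \<longlonglongrightarrow> dist w p"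
      by (intro tendsto_intros zw qh)
    then have "(\<lambda>n. infdist (z n) (A (h n) k)) \<longlonglongrightarrow> dist w p"
      by (rule tendsto_cong[OF ev, THEN iffD2])
    from LIMSEQ_unique[OF tendsto_infdist_moving[OF Asub[OF \<open>w \<in> X\<close>] zw] this]
    have "infdist w (B k) = dist w p" .
    moreover obtain a where a: "a \<in> B k" "infdist w (B k) = dist w a"
      by (rule infdist_attained[OF B])
    ultimately have wa: "dist w a = dist w p" by simp
    have "dist x p = dist x w + dist w p"
    proof -
      have eqs: "x - w = (1 - t) *\<^sub>R (x - p)" "w - p = t *\<^sub>R (x - p)" by (simp_all add: w_def algebra_simps)
      have "norm ((1 - t) *\<^sub>R (x - p)) + norm (t *\<^sub>R (x - p)) = norm (x - p)"
        using h(1) by (simp add: left_diff_distrib)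
      then show ?thesis by (simp add: dist_norm eqs)
    qed
    then have "a = p"
    proof (rule uniformly_convex_nearest_unique[OF assms(1) _ wa _ \<open>x \<noteq> w\<close>])
      show "dist x p \<le> dist x a"
        using x(2) p(2) infdist_le[OF a(1), of x] by simp
    qed
    \<comment> \<open>Now \<open>p\<close> lies in a rival limit region \<open>L j\<close> and also
      in \<open>P k\<close>, hence in \<open>B j\<close>. The inclusion already proved, used for
      \<open>j\<close>, gives it distance 0 from \<open>P j\<close>, contradicting
      disjointness.\<close>
    then obtain j where j: "j \<in> K" "j \<noteq> k" "p \<in> L j" using a(1) by (auto simp: B_def)
    have "p \<in> B j" using PL[OF k] p(1) k j(2) by (auto simp: B_def)
    then have "infdist p (P j) \<le> 0" using near[OF j(1,3)] by simp
    then have "p \<in> P j"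
      using in_closed_iff_infdist_zero[of "P j" p] P(1,3)[OF j(1)] infdist_nonneg[of p "P j"]
      by (auto simp: compact_imp_closed)
    then show False
      using \<open>disjoint_family_on P K\<close> j(1,2) k p(1) by (auto simp: disjoint_family_on_def)
  qed
  have "zone_diagram X K P L"
    unfolding zone_diagram_def dominance_region_def B_def[symmetric]
  proof (intro conjI ballI)
    fix k assume k: "k \<in> K"
    show "L k = {x \<in> X. infdist x (P k) \<le> infdist x (B k)}"
      using near[OF k] far[OF k] LX[of k] by auto
  qed (simp_all add: L(2) LX)
  then show ?thesis by blast
qed

end
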